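(* Let $Z,W$ be nonempty words over $\{L,M,R\}$ with $ZW=\overline{W}\,\overline{Z}$, where $|ZW|=m$ and $|W|=r$. Let $d=\gcd(m,r)$. Then one of the following occurs: (1) $|Z|=|W|$ implies $Z=\overline{W}$. (2) $|Z|\neq|W|$ implies: (a) if $\frac{m}{d}$ is even, then $Z=(\overline{E}E)^{(\frac{m-r}{d}-1)/2}\,\overline{E}$ and $W=(E\overline{E})^{(\frac{r}{d}-1)/2}E$, where $\overline{E}$ is a left factor of $Z$ of length $d$; hence $Z$ and $W$ are broken alternating words; or (b) if $\frac{m}{d}$ is odd, then $ZW=M^{m}$.
   Context: Words are finite sequences over the alphabet $\{L,M,R\}$; $|w|$ denotes length, and $w^k$ is the $k$-fold concatenation ($w^0$ is the empty word). The complement $\overline{w}$ is obtained letterwise from $\overline{R}=L$, $\overline{L}=R$, $\overline{M}=M$. A word $v$ is a left factor of a word $x$ if $x=vx_1$ for some (possibly empty) word $x_1$. A word $w$ is called a broken alternating word if it is of the form $w=(w_1\overline{w_1})^{n}w_0$, where $n$ is a positive integer and $w_0$ is a left factor of $w_1\overline{w_1}$.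
   Formalization: In (2)(a), "Z and W are broken alternating words" is stated for each of Z, W only when its length exceeds d; a factor of length d need not be one (Z=L, W=RLR), since n must be positive. *)

theory Defs
  imports Complex_Main "HOL-Library.Sublist"
begin

datatype letter = L | M | R

type_synonym word = "letter list"

fun letter_compl :: "letter \<Rightarrow> letter" where
  "letter_compl L = R"
| "letter_compl M = M"
| "letter_compl R = L"

definition compl :: "word \<Rightarrow> word" where
  "compl w = map letter_compl w"

definition word_pow :: "word \<Rightarrow> nat \<Rightarrow> word" where
  "word_pow w k = concat (replicate k w)"

definition broken_alternating :: "word \<Rightarrow> bool" where
  "broken_alternating w \<longleftrightarrow>
    (\<exists>w1 n w0. n > 0 \<and> prefix w0 (w1 @ compl w1) \<and> w = word_pow (w1 @ compl w1) n @ w0)"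

(* Because n is positive, a nonempty broken alternating word has at least two letters.
   Hence in a solution of Z W = compl W compl Z with |Z| \<noteq> |W| and m / d even, a factor
   of length exactly d (Z = compl E or W = E) need not be broken alternating, as the following
   solution with m = 4, r = 3, d = 1 shows. *)
lemma length_d_factor_not_broken_alternating:
  defines "Z \<equiv> [L]" and "W \<equiv> [R, L, R]"
  shows "Z @ W = compl W @ compl Z" and "\<not> broken_alternating Z"
proof -
  show "Z @ W = compl W @ compl Z"
    by (simp add: Z_def W_def compl_def)
  show "\<not> broken_alternating Z"
  proof
    assume "broken_alternating Z"
    then obtain w1 n w0 where "n > 0" and p: "prefix w0 (w1 @ compl w1)"
      and eq: "[L] = word_pow (w1 @ compl w1) n @ w0"
      by (auto simp: broken_alternating_def Z_def)
    then obtain k where "n = Suc k" by (cases n) auto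
    with eq have eq': "[L] = w1 @ compl w1 @ word_pow (w1 @ compl w1) k @ w0"
      by (simp add: word_pow_def)
    show False
    proof (cases w1)
      case Nil
      then have "w0 = []" using p by (simp add: compl_def)
      with eq' Nil show False by (simp add: compl_def word_pow_def)
    next
      case (Cons a w)
      with eq' show False by (simp add: compl_def)
    qed
  qed
qed

end

(* With x = Z W, the equation says that x ! ((i + r) mod m) is the complement of x ! i for every i < m.
   Iterating the cyclic shift by r yields the shift by d = gcd m r (Bezout) and, after m / d steps,
   the identity. If m / d is odd, every letter is thus its own complement, i.e. M. If m / d is even,
   then r / d and the Bezout coefficient are odd, so shifting by d complements x, and x alternates
   between complementary blocks of length d. *)
theory Submission
  imports Defs
begin

lemma letter_compl_letter_compl [simp]: "letter_compl (letter_compl a) = a"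
  by (cases a) auto

lemma eq_letter_compl_iff: "a = letter_compl a \<longleftrightarrow> a = M"
  by (cases a) auto

lemma compl_compl [simp]: "compl (compl w) = w"
  by (induction w) (auto simp: compl_def)

lemma length_compl [simp]: "length (compl w) = length w"
  by (simp add: compl_def)

lemma letter_compl_funpow:
  "(letter_compl ^^ k) a = (if even k then a else letter_compl a)"
  by (induction k) auto

lemma word_pow_singleton: "word_pow [a] k = replicate k a"
  by (induction k) (auto simp: word_pow_def)

text \<open>Reducing modulo the length after every step or only at the end leads to the same
  position, so \<open>k\<close> shifts compose to one shift by \<open>r * k\<close>. Complements
  cancel in pairs, hence only the parity of \<open>k\<close> matters.\<close>

lemma cyclic_shift_iterate:
  fixes x :: word
  assumes shift: "\<And>i. i < length x \<Longrightarrow> x ! ((i + r) mod length x) = letter_compl (x ! i)"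
    and i: "i < length x"
  shows "x ! ((i + r * k) mod length x) = (if even k then x ! i else letter_compl (x ! i))"
proof -
  have "x ! ((i + r * k) mod length x) = (letter_compl ^^ k) (x ! i)"
  proof (induction k)
    case 0
    show ?case using i by simp
  next
    case (Suc k)
    have "(i + r * Suc k) mod length x = ((i + r * k) mod length x + r) mod length x"
      by (metis add.assoc add.commute mod_add_left_eq mult_Suc_right)
    moreover have "(i + r * k) mod length x < length x"
      using i by (intro mod_less_divisor) linarith
    ultimately show ?case
      using shift Suc by simp
  qed
  then show ?thesis
    by (simp add: letter_compl_funpow)
qed

text \<open>Induction peels off two blocks of length \<open>d\<close> at a time: one shift by
  \<open>d\<close> makes the second block the complement of the first, and two shifts make the third
  block equal to the first, so the remainder starts with the same block. The number of blocks is
  odd, so a single block is left at the end.\<close>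

lemma alternating_blocks:
  assumes "length w = (2 * k + 1) * d"
    and "\<And>i. i + d < length w \<Longrightarrow> w ! (i + d) = letter_compl (w ! i)"
  shows "w = word_pow (take d w @ compl (take d w)) k @ take d w"
  using assms
proof (induction k arbitrary: w)
  case 0
  then show ?case by (simp add: word_pow_def)
next
  case (Suc k)
  let ?v = "drop (2 * d) w"
  have len: "length w = 2 * d + (2 * k + 1) * d"
    using Suc.prems(1) by (simp add: algebra_simps)
  have alt: "?v ! (i + d) = letter_compl (?v ! i)" if "i + d < length ?v" for i
    using Suc.prems(2)[of "i + 2 * d"] that len by (simp add: ac_simps)
  have 1: "take d (drop d w) = compl (take d w)"
  proof (rule nth_equalityI)
    fix i assume "i < length (take d (drop d w))"
    then have "i < d" "d + i < length w" by auto
    then show "take d (drop d w) ! i = compl (take d w) ! i"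
      using Suc.prems(2)[of i] by (simp add: compl_def add.commute)
  qed (use len in simp)
  have 2: "take d ?v = take d w"
  proof (rule nth_equalityI)
    fix i assume "i < length (take d ?v)"
    then have "i < d" "2 * d + i < length w" by auto
    then show "take d ?v ! i = take d w ! i"
      using Suc.prems(2)[of i] Suc.prems(2)[of "d + i"]
      by (simp add: mult_2 add_ac)
  qed (use len in simp)
  have "w = take d w @ take d (drop d w) @ ?v"
    by (metis append_take_drop_id drop_drop mult_2)
  moreover have "?v = word_pow (take d ?v @ compl (take d ?v)) k @ take d ?v"
    by (rule Suc.IH) (use len alt in auto)
  ultimately show ?case
    unfolding 1 2 by (simp add: word_pow_def)
qed

text \<open>The strict inequality rules out \<open>k = 0\<close>, where the word would be
  \<open>E\<close> alone; the definition demands a positive exponent.\<close>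

lemma broken_alternating_blocks:
  assumes "w = word_pow (E @ compl E) k @ E" "length E < length w"
  shows "broken_alternating w"
proof -
  have "k > 0"
    using assms by (cases k) (auto simp: word_pow_def)
  then show ?thesis
    unfolding broken_alternating_def
    by (intro exI[of _ E] exI[of _ k] conjI assms(1)) auto
qed

text \<open>The two sides of the equation are two readings of one word. A letter of \<open>Z\<close>
  reappears complemented in \<open>compl Z\<close>, which starts at offset \<open>length W\<close>;
  a letter of \<open>W\<close> reappears in the initial \<open>compl W\<close>, which is where the
  shift wraps around.\<close>

lemma cyclic_shift_compl:
  assumes "Z @ W = compl W @ compl Z" and i: "i < length (Z @ W)"
  shows "(Z @ W) ! ((i + length W) mod length (Z @ W)) = letter_compl ((Z @ W) ! i)"
proof (cases "i < length Z")
  case True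
  then have "(Z @ W) ! (i + length W) = letter_compl (Z ! i)"
    unfolding assms(1) by (simp add: nth_append compl_def)
  with True show ?thesis by (simp add: nth_append)
next
  case False
  then obtain j where j: "i = length Z + j" "j < length W"
    using i by (metis add_less_cancel_left le_Suc_ex length_append not_less)
  then have "i + length W = j + length (Z @ W)"
    by simp
  then have "(i + length W) mod length (Z @ W) = j"
    using j(2) by (metis length_append mod_add_self2 mod_less trans_less_add2)
  moreover have "(Z @ W) ! j = letter_compl (W ! j)"
    unfolding assms(1) using j by (simp add: nth_append compl_def)
  ultimately show ?thesis using j by (simp add: nth_append)
qed

theorem proposition3p1:
  fixes Z W :: word and m r d :: nat
  assumes "Z \<noteq> []" and "W \<noteq> []"
    and "Z @ W = compl W @ compl Z"
    and "m = length (Z @ W)" and "r = length W" and "d = gcd m r"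
  shows "(length Z = length W \<longrightarrow> Z = compl W) \<and>
    (length Z \<noteq> length W \<longrightarrow>
      (even (m div d) \<longrightarrow>
        (\<exists>E. length E = d \<and> prefix (compl E) Z \<and>
          Z = word_pow (compl E @ E) (((m - r) div d - 1) div 2) @ compl E \<and>
          W = word_pow (E @ compl E) ((r div d - 1) div 2) @ E) \<and>
        (d < length Z \<longrightarrow> broken_alternating Z) \<and>
        (d < length W \<longrightarrow> broken_alternating W)) \<and>
      (odd (m div d) \<longrightarrow> Z @ W = word_pow [M] m))"
proof (intro conjI impI)
  assume "length Z = length W"
  with assms(3) show "Z = compl W"
    by (metis append_eq_append_conv length_compl)
next
  let ?x = "Z @ W"
  note shift = cyclic_shift_iterate[OF cyclic_shift_compl[OF assms(3)]]
  assume "odd (m div d)"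
  \<comment> \<open>After \<open>m div d\<close> shifts the total displacement is a multiple of
    \<open>m\<close>, so position \<open>i\<close> is reached again after an odd number of
    complements.\<close>
  have "r * (m div d) = m * (r div d)"
    using assms(6) by (metis div_mult_swap gcd_dvd1 gcd_dvd2 mult.commute)
  then have "?x ! i = M" if "i < m" for i
    using shift[of i "m div d"] that \<open>odd (m div d)\<close> assms(4,5)
    by (simp add: eq_letter_compl_iff del: length_append)
  then have "?x = replicate m M"
    using assms(4) by (intro nth_equalityI) (simp_all del: length_append)
  then show "?x = word_pow [M] m"
    by (simp only: word_pow_singleton)
next
  let ?x = "Z @ W"
  note shift = cyclic_shift_iterate[OF cyclic_shift_compl[OF assms(3)]]
  assume even: "even (m div d)"
  have r: "r > 0" and m: "m = length Z + r"
    using assms(2,4,5) by auto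
  then have d: "d > 0"
    using assms(6) by simp
  have "d dvd m" "d dvd r"
    using assms(6) by auto
  then obtain m' r' where m': "m = d * m'" and r': "r = d * r'"
    by (auto simp: dvd_def)
  \<comment> \<open>Bezout: \<open>k\<close> shifts by \<open>r\<close> amount to one shift by
    \<open>d\<close> modulo \<open>m\<close>.\<close>
  obtain k y where k: "r * k = m * y + d"
    using bezout_nat[of r m] r assms(6) by (metis gcd.commute less_numeral_extra(3))
  \<comment> \<open>Cancelling \<open>d\<close> shows that \<open>r' * k\<close> exceeds a multiple
    of the even number \<open>m'\<close> by one, which forces both factors to be odd.\<close>
  then have "d * (r' * k) = d * (m' * y + 1)"
    unfolding m' r' by (simp add: algebra_simps)
  then have "r' * k = m' * y + 1"
    using d by (metis mult_cancel1 less_numeral_extra(3))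
  moreover have "even m'"
    using even m' d by simp
  ultimately have "odd (r' * k)" by simp
  then have "odd r'" "odd k" by auto
  \<comment> \<open>The bound \<open>i + d < m\<close> excludes wrapping around, so the cyclic
    relation becomes a plain one that can be restricted to the factors \<open>Z\<close> and
    \<open>W\<close>.\<close>
  have alt: "?x ! (i + d) = letter_compl (?x ! i)" if "i + d < m" for i
  proof -
    have "(i + r * k) mod m = (i + d + m * y) mod m"
      using k by (simp add: ac_simps)
    also have "\<dots> = i + d"
      using that by simp
    finally show ?thesis
      using shift[of i k] that \<open>odd k\<close> assms(4,5) by (simp del: length_append)
  qed
  have lenZ: "length Z = d * (m' - r')"
    using m m' r' by (simp add: diff_mult_distrib2)
  \<comment> \<open>Since \<open>Z\<close> is nonempty, the subtraction \<open>m' - r'\<close> is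
    not truncated, and its parity is that of even minus odd.\<close>
  have "r' < m'"
    using m m' r' d assms(1) by (metis less_add_same_cancel2 length_greater_0_conv mult_less_cancel1)
  then have oddZ: "odd (m' - r')"
    using \<open>odd r'\<close> \<open>even m'\<close> by simp
  have half: "2 * ((n - 1) div 2) + 1 = n" if "odd n" for n :: nat
    using that by presburger
  define E where "E = take d W"
  have le: "d \<le> length Z" "d \<le> length W"
    using lenZ r' odd_pos[OF oddZ] odd_pos[OF \<open>odd r'\<close>] assms(5) by auto
  \<comment> \<open>Both \<open>Z\<close> and \<open>compl W\<close> have length at least
    \<open>d\<close>, so comparing the first \<open>d\<close> letters of the two sides links the
    initial blocks of \<open>Z\<close> and \<open>W\<close>.\<close>
  have "take d ?x = take d (compl W @ compl Z)"
    using assms(3) by simp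
  then have E: "take d Z = compl E"
    using le by (simp add: E_def compl_def take_map)
  have Z: "Z = word_pow (compl E @ E) (((m - r) div d - 1) div 2) @ compl E"
  proof -
    have "Z = word_pow (take d Z @ compl (take d Z)) ((m' - r' - 1) div 2) @ take d Z"
    proof (rule alternating_blocks)
      show "length Z = (2 * ((m' - r' - 1) div 2) + 1) * d"
        using lenZ half[OF oddZ] by (metis mult.commute)
      show "Z ! (i + d) = letter_compl (Z ! i)" if "i + d < length Z" for i
        using alt[of i] that m by (simp add: nth_append)
    qed
    moreover have "(m - r) div d = m' - r'"
      using m' r' d by (simp flip: diff_mult_distrib2)
    ultimately show ?thesis by (simp add: E)
  qed
  have W: "W = word_pow (E @ compl E) ((r div d - 1) div 2) @ E"
  proof -
    have "W = word_pow (take d W @ compl (take d W)) ((r' - 1) div 2) @ take d W"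
    proof (rule alternating_blocks)
      show "length W = (2 * ((r' - 1) div 2) + 1) * d"
        using r' half[OF \<open>odd r'\<close>] assms(5) by (metis mult.commute)
      show "W ! (i + d) = letter_compl (W ! i)" if "i + d < length W" for i
        using alt[of "length Z + i"] that m assms(5) by (simp add: nth_append add.assoc)
    qed
    moreover have "r div d = r'"
      using r' d by simp
    ultimately show ?thesis by (simp add: E_def)
  qed
  have lenE: "length E = d"
    using le by (simp add: E_def)
  show "\<exists>E. length E = d \<and> prefix (compl E) Z \<and>
          Z = word_pow (compl E @ E) (((m - r) div d - 1) div 2) @ compl E \<and>
          W = word_pow (E @ compl E) ((r div d - 1) div 2) @ E"
    using lenE Z W by (intro exI[of _ E]) (auto simp flip: E intro: take_is_prefix)
  show "broken_alternating Z" if "d < length Z"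
    using Z that lenE by (intro broken_alternating_blocks[of Z "compl E"]) auto
  show "broken_alternating W" if "d < length W"
    using W that lenE by (intro broken_alternating_blocks[of W E]) auto
qed

end
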